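(* For an integer $d\geq 2$, let $\mathrm{PCF}_d$ be the set of $c\in\overline{\mathbb{Q}}$ such that the polynomial $f(x)=x^d+c$ is post-critically finite, i.e. the forward orbit $0, f(0), f^2(0), \dots$ of the critical point $0$ under iteration of $f$ takes only finitely many distinct values. Let $\mathbb{Q}^{\mathrm{tr}}$ be the maximal totally real subfield of $\overline{\mathbb{Q}}$ (the set of algebraic numbers all of whose complex embeddings are real). Then $\mathrm{PCF}_2\cap\mathbb{Q}^{\mathrm{tr}}=\{-2,-1,0\}$; $\mathrm{PCF}_d\cap\mathbb{Q}^{\mathrm{tr}}=\{-1,0\}$ if $d\geq 4$ is even; $\mathrm{PCF}_d\cap\mathbb{Q}^{\mathrm{tr}}=\{0\}$ if $d\geq 3$ is odd.
   Context: $f^n$ denotes the $n$-fold composition of $f$ with itself. An algebraic number $c$ is totally real if its minimal polynomial over $\mathbb{Q}$ has only real roots. *)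

theory Defs
  imports "HOL-Computational_Algebra.Polynomial"
begin

text \<open>
  Algebraic numbers are taken inside the type \<^typ>\<open>complex\<close>.
\<close>

definition Qbar :: "complex set" where
  "Qbar = {c. algebraic c}"

definition is_min_poly :: "rat poly \<Rightarrow> complex \<Rightarrow> bool" where
  "is_min_poly p c \<longleftrightarrow>
     lead_coeff p = 1 \<and> poly (map_poly of_rat p) c = 0 \<and>
     (\<forall>q. q \<noteq> 0 \<longrightarrow> poly (map_poly of_rat q) c = 0 \<longrightarrow> degree p \<le> degree q)"

text \<open>
  Only meaningful for algebraic \<open>c\<close>; see \<open>is_min_poly_min_poly\<close> below.
\<close>

definition min_poly :: "complex \<Rightarrow> rat poly" where
  "min_poly c = (THE p. is_min_poly p c)"

lemma is_min_poly_unique: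
  assumes "is_min_poly p c" "is_min_poly q c"
  shows "p = q"
proof (rule ccontr)
  assume "p \<noteq> q"
  hence ne: "p - q \<noteq> 0" by simp
  have nz: "p \<noteq> 0" "q \<noteq> 0" using assms by (auto simp: is_min_poly_def)
  have deg: "degree p = degree q"
    using assms nz unfolding is_min_poly_def by (metis antisym)
  have "map_poly of_rat (p - q) = map_poly of_rat p - (map_poly of_rat q :: complex poly)"
    by (rule poly_eqI) (simp add: coeff_map_poly of_rat_diff)
  hence "poly (map_poly of_rat (p - q)) c = 0"
    using assms by (simp add: is_min_poly_def)
  hence le: "degree p \<le> degree (p - q)"
    using assms(1) ne by (auto simp: is_min_poly_def)
  have "degree (p - q) \<le> degree p"
    using deg by (intro degree_diff_le) auto
  with le have eq: "degree (p - q) = degree p" by simp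
  have "coeff (p - q) (degree p) = 0"
    using assms deg by (simp add: is_min_poly_def)
  with eq ne show False by (metis leading_coeff_0_iff)
qed

lemma is_min_poly_min_poly:
  assumes "algebraic c"
  shows "is_min_poly (min_poly c) c"
proof -
  define Z where "Z = (\<lambda>q :: rat poly. q \<noteq> 0 \<and> poly (map_poly of_rat q) c = 0)"
  obtain r where r: "poly (map_poly of_int r) c = 0" "r \<noteq> 0"
    using assms by (elim algebraicE')
  have "map_poly of_rat (map_poly of_int r :: rat poly) = (map_poly of_int r :: complex poly)"
    by (rule poly_eqI) (simp add: coeff_map_poly)
  moreover have "(map_poly of_int r :: rat poly) \<noteq> 0"
    using r(2) by (simp add: map_poly_eq_0_iff)
  ultimately have "Z (map_poly of_int r)" using r(1) by (simp add: Z_def)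
  then obtain q where q: "Z q" "\<And>q'. Z q' \<Longrightarrow> degree q \<le> degree q'"
    using ex_has_least_nat[of Z _ degree] by metis
  define p where "p = smult (inverse (lead_coeff q)) q"
  have "map_poly of_rat p = smult (of_rat (inverse (lead_coeff q))) (map_poly of_rat q :: complex poly)"
    by (rule poly_eqI) (simp add: p_def coeff_map_poly of_rat_mult)
  hence "is_min_poly p c"
    using q by (auto simp: is_min_poly_def Z_def p_def)
  thus ?thesis
    unfolding min_poly_def by (rule theI) (metis is_min_poly_unique \<open>is_min_poly p c\<close>)
qed

definition totally_real :: "complex \<Rightarrow> bool" where
  "totally_real c \<longleftrightarrow>
     algebraic c \<and> (\<forall>z :: complex. poly (map_poly of_rat (min_poly c)) z = 0 \<longrightarrow> z \<in> \<real>)"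

text \<open>
  The complex embeddings of an algebraic number are the roots of its minimal polynomial, so
  this is the set of algebraic numbers all of whose complex embeddings are real.
\<close>

definition Qtr :: "complex set" where
  "Qtr = {c. totally_real c}"

definition unicritical :: "nat \<Rightarrow> complex \<Rightarrow> complex \<Rightarrow> complex" where
  "unicritical d c x = x ^ d + c"

definition critical_orbit :: "nat \<Rightarrow> complex \<Rightarrow> complex set" where
  "critical_orbit d c = range (\<lambda>n. (unicritical d c ^^ n) 0)"

definition PCF :: "nat \<Rightarrow> complex set" where
  "PCF d = {c \<in> Qbar. finite (critical_orbit d c)}"

end

theory Submission
  imports Defs "HOL-Computational_Algebra.Fundamental_Theorem_Algebra"
begin

text \<open>
  If \<open>c\<close> is a parameter in question, then \<open>c\<close> is a root of the monic integer polynomial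
  \<open>f\<^sup>n(0) - f\<^sup>m(0)\<close> in \<open>c\<close>, so \<open>c\<close> is an algebraic integer whose conjugates are again
  post-critically finite and real. Real dynamics excludes all nonzero parameters for odd \<open>d\<close>,
  and for even \<open>d\<close> it confines the conjugates to \<open>[-2, 0]\<close>, excluding \<open>-2\<close> if \<open>d \<ge> 4\<close>.
  So all conjugates of the algebraic integer \<open>c + 1\<close> lie in \<open>[-1, 1]\<close>; its norm being an
  integer, either \<open>c + 1 = 0\<close> or all of them have absolute value \<open>1\<close>.
\<close>

section \<open>Minimal polynomials of algebraic integers\<close>

lemma map_poly_of_int_mult:
  "map_poly of_int (p * q) =
     (map_poly of_int p * map_poly of_int q :: 'a :: {comm_ring_1, ring_char_0} poly)"
  by (rule poly_eqI) (simp add: coeff_map_poly coeff_mult)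

lemma map_poly_of_int_add:
  "map_poly of_int (p + q) = (map_poly of_int p + map_poly of_int q :: 'a :: ring_1 poly)"
  by (rule poly_eqI) (simp add: coeff_map_poly)

lemma map_poly_of_int_diff:
  "map_poly of_int (p - q) = (map_poly of_int p - map_poly of_int q :: 'a :: ring_1 poly)"
  by (rule poly_eqI) (simp add: coeff_map_poly)

lemma map_poly_of_int_power:
  "map_poly of_int (p ^ n) = (map_poly of_int p ^ n :: 'a :: {comm_ring_1, ring_char_0} poly)"
  by (induction n) (simp_all add: map_poly_of_int_mult)

lemma poly_map_poly_of_int:
  "poly (map_poly of_int p) (of_int k) = (of_int (poly p k) :: 'a :: comm_ring_1)"
  by (induction p) (simp_all add: map_poly_pCons)

lemma map_poly_of_rat_mult:
  "map_poly of_rat (p * q) = (map_poly of_rat p * map_poly of_rat q :: 'a :: field_char_0 poly)"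
  by (rule poly_eqI) (simp add: coeff_map_poly coeff_mult of_rat_sum of_rat_mult)

lemma map_poly_of_rat_add:
  "map_poly of_rat (p + q) = (map_poly of_rat p + map_poly of_rat q :: 'a :: field_char_0 poly)"
  by (rule poly_eqI) (simp add: coeff_map_poly of_rat_add)

lemma map_poly_of_rat_of_int:
  "map_poly of_rat (map_poly of_int p) = (map_poly of_int p :: 'a :: field_char_0 poly)"
  by (rule poly_eqI) (simp add: coeff_map_poly)

text \<open>The remainder \<open>q mod p\<close> also vanishes at \<open>c\<close>, and its degree
  is too small for a nonzero polynomial doing so.\<close>

lemma is_min_poly_dvd:
  assumes "is_min_poly p c" "poly (map_poly of_rat q) c = 0"
  shows "p dvd q"
proof (rule ccontr)
  assume "\<not> p dvd q"
  hence ne: "q mod p \<noteq> 0" by (simp add: dvd_eq_mod_eq_0)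
  have p0: "p \<noteq> 0" using assms(1) by (auto simp: is_min_poly_def)
  have "map_poly of_rat q =
      (map_poly of_rat (q div p) * map_poly of_rat p + map_poly of_rat (q mod p) :: complex poly)"
    by (simp flip: map_poly_of_rat_mult map_poly_of_rat_add)
  hence "poly (map_poly of_rat (q mod p)) c = 0"
    using assms by (simp add: is_min_poly_def)
  hence "degree p \<le> degree (q mod p)"
    using assms(1) ne by (auto simp: is_min_poly_def)
  with degree_mod_less[OF p0, of q] ne show False by simp
qed

section \<open>Gauss's lemma for monic factors\<close>

lemma clear_denominators:
  fixes p :: "rat poly"
  shows "\<exists>a>0. \<exists>P. smult (of_int a) p = map_poly of_int P"
proof (induction p)
  case 0
  show ?case by (intro exI[of _ 1] conjI exI[of _ 0]) auto
next
  case (pCons x p)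
  then obtain a P where a: "a > 0" "smult (of_int a) p = map_poly of_int P" by blast
  obtain m n where x: "x = Fract m n" "n > 0" by (cases x) auto
  have "of_int (a * n) * x = of_int (a * m)"
    using x by (simp add: Fract_of_int_quotient)
  moreover have "smult (of_int (a * n)) p = map_poly of_int (smult n P)"
  proof -
    have "smult (of_int (a * n)) p = smult (of_int n) (smult (of_int a) p)"
      by (simp add: mult.commute)
    also have "\<dots> = map_poly of_int (smult n P)"
      unfolding a(2) by (rule poly_eqI) (simp add: coeff_map_poly)
    finally show ?thesis .
  qed
  ultimately have "smult (of_int (a * n)) (pCons x p) =
      map_poly of_int (pCons (a * m) (smult n P))"
    by (simp add: map_poly_pCons)
  thus ?case using a(1) x(2) by (metis mult_pos_pos)
qed

text \<open>Clearing denominators gives \<open>A * B = smult (a * b) P\<close> with \<open>P\<close>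
  primitive, so the contents of \<open>A\<close> and \<open>B\<close> multiply to
  \<open>a * b\<close>. As they divide the leading coefficients \<open>a\<close> and
  \<open>b\<close>, they equal them, and \<open>A\<close> can be divided by
  \<open>a\<close>.\<close>

lemma monic_factor_integral:
  fixes p q :: "rat poly" and P :: "int poly"
  assumes "map_poly of_int P = p * q" "lead_coeff P = 1" "lead_coeff p = 1"
  shows "\<exists>Q. p = map_poly of_int Q"
proof -
  obtain a A where a: "a > 0" "smult (of_int a) p = map_poly of_int A"
    using clear_denominators by blast
  obtain b B where b: "b > 0" "smult (of_int b) q = map_poly of_int B"
    using clear_denominators by blast
  have "lead_coeff (p * q) = 1"
    using assms(2) by (simp flip: assms(1) add: coeff_map_poly degree_map_poly)
  hence lq: "lead_coeff q = 1" using assms(3) by (simp add: lead_coeff_mult)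
  have lA: "lead_coeff A = a"
  proof -
    have "(of_int (lead_coeff A) :: rat) = lead_coeff (map_poly of_int A)"
      by (simp add: coeff_map_poly degree_map_poly)
    also have "\<dots> = of_int a" using a assms(3) by (simp flip: a(2))
    finally show ?thesis by simp
  qed
  have lB: "lead_coeff B = b"
  proof -
    have "(of_int (lead_coeff B) :: rat) = lead_coeff (map_poly of_int B)"
      by (simp add: coeff_map_poly degree_map_poly)
    also have "\<dots> = of_int b" using b lq by (simp flip: b(2))
    finally show ?thesis by simp
  qed
  have "map_poly of_int (A * B) = (map_poly of_int (smult (a * b) P) :: rat poly)"
  proof -
    have "map_poly of_int (A * B) = smult (of_int a) p * smult (of_int b) q"
      by (simp add: map_poly_of_int_mult a b)
    also have "\<dots> = smult (of_int (a * b)) (map_poly of_int P)"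
      by (simp add: assms(1) mult.commute)
    also have "\<dots> = map_poly of_int (smult (a * b) P)"
      by (rule poly_eqI) (simp add: coeff_map_poly)
    finally show ?thesis .
  qed
  hence AB: "A * B = smult (a * b) P"
    by (simp add: poly_eq_iff coeff_map_poly flip: of_int_mult)
  have "content P dvd 1" using content_dvd_coeff[of P "degree P"] assms(2) by simp
  hence "content P = 1" by (rule is_unit_content_iff[THEN iffD1])
  hence "content A * content B = a * b"
    using arg_cong[OF AB, of content] a(1) b(1) by (simp add: content_mult)
  moreover have "content A dvd a" "content B dvd b"
    using content_dvd_coeff[of A "degree A"] content_dvd_coeff[of B "degree B"] lA lB by simp_all
  \<comment> \<open>Two positive numbers bounded by \<open>a\<close> and \<open>b\<close> with
    product \<open>a * b\<close> attain both bounds.\<close>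
  ultimately have "content A = a"
    using a(1) b(1)
    by (smt (verit) mult_strict_mono normalize_content abs_ge_zero zdvd_imp_le normalize_int_def
        mult_less_cancel_right mult_left_mono)
  then obtain Q where Q: "A = smult a Q"
    by (metis content_times_primitive_part)
  have "smult (of_int a) p = smult (of_int a) (map_poly of_int Q)"
    unfolding a(2) Q by (rule poly_eqI) (simp add: coeff_map_poly)
  hence "p = map_poly of_int Q"
    using a(1) smult_cancel[of "of_int a :: rat"] by (metis less_irrefl of_int_eq_0_iff)
  thus ?thesis by blast
qed

lemma is_min_poly_integral:
  assumes "is_min_poly p c" "algebraic_int c"
  shows "\<exists>Q. p = map_poly of_int Q"
proof -
  obtain P where P: "poly (map_poly of_int P) c = 0" "lead_coeff P = 1"
    using assms(2) unfolding algebraic_int_altdef_ipoly by blast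
  have "p dvd map_poly of_int P"
    using assms(1) P(1) by (intro is_min_poly_dvd) (simp_all add: map_poly_of_rat_of_int)
  then obtain q where "map_poly of_int P = p * q" by blast
  thus ?thesis using P(2) assms(1) by (intro monic_factor_integral) (auto simp: is_min_poly_def)
qed

text \<open>\<open>poly p x\<close> is the product of \<open>x - z\<close> over the roots
  \<open>z\<close> with multiplicity: no factor exceeds 1 in modulus, and the one at
  \<open>c\<close> is strictly smaller.\<close>

lemma norm_poly_less_1:
  fixes p :: "complex poly"
  assumes "lead_coeff p = 1" "\<And>z. poly p z = 0 \<Longrightarrow> norm (x - z) \<le> 1"
      and "poly p c = 0" "norm (x - c) < 1"
  shows "norm (poly p x) < 1"
proof -
  obtain root where root: "smult (lead_coeff p) (\<Prod>i<degree p. [:- root i, 1:]) = p"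
    by (rule complex_poly_decompose')
  have eq: "poly p y = (\<Prod>i<degree p. y - root i)" for y
    using arg_cong[OF root, of "\<lambda>q. poly q y"] assms(1) by (simp add: poly_prod)
  obtain j where j: "j < degree p" "c = root j"
    using assms(3) unfolding eq by auto
  have le: "norm (x - root i) \<le> 1" if "i < degree p" for i
    using that by (intro assms(2)) (auto simp: eq)
  have "norm (poly p x) = norm (x - c) * (\<Prod>i\<in>{..<degree p} - {j}. norm (x - root i))"
    using j by (simp add: eq prod_norm prod.remove[of _ j] norm_mult)
  also have "\<dots> \<le> norm (x - c) * 1"
    using le by (intro mult_left_mono prod_le_1) auto
  finally show ?thesis using assms(4) by simp
qed

text \<open>The value of \<open>p\<close> at \<open>k\<close> is the product of the differences
  between \<open>k\<close> and the conjugates of \<open>c\<close>, and it is an integer. If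
  \<open>c\<close> were at distance strictly between 0 and 1 from \<open>k\<close>, this integer
  would have modulus below 1, hence be 0, contradicting the minimality of \<open>p\<close>.\<close>

lemma algebraic_int_conjugates_near_int:
  assumes c: "algebraic_int c" and p: "is_min_poly p c"
      and near: "\<And>z :: complex. poly (map_poly of_rat p) z = 0 \<Longrightarrow> norm (of_int k - z) \<le> 1"
  shows "c = of_int k \<or> norm (of_int k - c) = 1"
proof (rule ccontr)
  assume *: "\<not> ?thesis"
  obtain Q where Q: "p = map_poly of_int Q"
    using is_min_poly_integral[OF p c] by blast
  have root: "poly (map_poly of_rat p) c = 0" and lead: "lead_coeff p = 1"
    using p by (auto simp: is_min_poly_def)
  have "norm (poly (map_poly of_rat p) (of_int k :: complex)) < 1"
  proof (rule norm_poly_less_1)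
    show "lead_coeff (map_poly of_rat p :: complex poly) = 1"
      using lead by (simp add: coeff_map_poly degree_map_poly)
    show "norm (of_int k - c) < 1" using near[OF root] * by simp
  qed (use near root in auto)
  moreover have "poly (map_poly of_rat p) (of_int k :: complex) = of_int (poly Q k)"
    by (simp add: Q map_poly_of_rat_of_int poly_map_poly_of_int)
  ultimately have "poly Q k = 0" by simp
  hence "poly p (of_int k) = 0" by (simp add: Q poly_map_poly_of_int)
  then obtain r where r: "p = [:- of_int k, 1:] * r"
    by (auto simp: poly_eq_0_iff_dvd)
  have r0: "r \<noteq> 0" using r lead by auto
  \<comment> \<open>Since \<open>c\<close> differs from \<open>k\<close>, it is a root of the
    cofactor \<open>r\<close>, whose degree is one less than that of \<open>p\<close>.\<close>
  have "(map_poly of_rat p :: complex poly) = [:- of_int k, 1:] * map_poly of_rat r"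
    unfolding r map_poly_of_rat_mult by (simp add: map_poly_pCons of_rat_minus)
  hence "poly (map_poly of_rat r) c = 0"
    using root * by auto
  hence "degree p \<le> degree r"
    using p r0 by (auto simp: is_min_poly_def)
  moreover have "degree p = Suc (degree r)"
    using r0 unfolding r by (subst degree_mult_eq) auto
  ultimately show False by simp
qed

lemma totally_real_of_int: "totally_real (of_int k)"
proof -
  have "is_min_poly [:- of_int k, 1:] (of_int k)"
    unfolding is_min_poly_def
  proof (intro conjI allI impI)
    fix q :: "rat poly"
    assume q: "q \<noteq> 0" "poly (map_poly of_rat q) (of_int k :: complex) = 0"
    have "degree q \<noteq> 0"
    proof
      assume "degree q = 0"
      then obtain a where "q = [:a:]" by (rule degree_eq_zeroE)
      with q show False by (simp add: map_poly_pCons)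
    qed
    thus "degree [:- of_int k, 1:] \<le> degree q" by simp
  qed (simp_all add: map_poly_pCons of_rat_minus)
  moreover have alg: "algebraic (of_int k :: complex)"
    by (intro algebraic_int_imp_algebraic algebraic_int_of_int)
  ultimately have "min_poly (of_int k) = [:- of_int k, 1:]"
    using is_min_poly_unique is_min_poly_min_poly by blast
  with alg show ?thesis
    by (auto simp: totally_real_def map_poly_pCons of_rat_minus)
qed

section \<open>Conjugates of post-critically finite parameters\<close>

text \<open>The iterate \<open>f^n(0)\<close> as an integer polynomial in the parameter;
  \<open>[:0, 1:]\<close> stands for the indeterminate \<open>c\<close>.\<close>

fun orbit_poly :: "nat \<Rightarrow> nat \<Rightarrow> int poly" where
  "orbit_poly d 0 = 0"
| "orbit_poly d (Suc n) = orbit_poly d n ^ d + [:0, 1:]"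

lemma poly_orbit_poly:
  "poly (map_poly of_int (orbit_poly d n)) c = (unicritical d c ^^ n) 0"
  by (induction n)
    (simp_all add: unicritical_def map_poly_of_int_add map_poly_of_int_power map_poly_pCons)

lemma orbit_poly_monic:
  assumes "d \<ge> 2"
  shows "degree (orbit_poly d (Suc n)) = d ^ n \<and> lead_coeff (orbit_poly d (Suc n)) = 1"
proof (induction n)
  case 0
  show ?case using assms by (simp add: power_0_left)
next
  case (Suc n)
  define q where "q = orbit_poly d (Suc n) ^ d"
  have "degree q = d ^ Suc n" "lead_coeff q = 1"
    using Suc degree_power_eq[of "orbit_poly d (Suc n)" d] lead_coeff_power[of "orbit_poly d (Suc n)" d]
    by (fastforce simp: q_def simp del: orbit_poly.simps)+
  \<comment> \<open>The power has degree above 1, so adding the indeterminate leaves its leading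
    term intact.\<close>
  moreover have "d ^ Suc n > 1" using assms by (intro one_less_power) auto
  ultimately have "degree (q + [:0, 1:]) = d ^ Suc n" "lead_coeff (q + [:0, 1:]) = 1"
    by (simp_all add: degree_add_eq_left coeff_eq_0)
  thus ?case by (simp add: q_def)
qed

text \<open>Degrees grow strictly along the orbit, so the leading term of the later iterate
  survives. Index 0 is treated apart, as the formula \<open>d ^ n\<close> for the degree starts at
  \<open>Suc n\<close>.\<close>

lemma orbit_poly_diff_monic:
  assumes "d \<ge> 2" "m < n"
  shows "lead_coeff (orbit_poly d n - orbit_poly d m) = 1"
proof -
  obtain k where k: "n = Suc k" using assms(2) by (cases n) auto
  show ?thesis
  proof (cases m)
    case 0
    thus ?thesis using orbit_poly_monic[OF assms(1), of k] k by (auto simp del: orbit_poly.simps(2))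
  next
    case (Suc l)
    have "d ^ l < d ^ k" using assms Suc k by (intro power_strict_increasing) auto
    hence deg: "degree (orbit_poly d m) < degree (orbit_poly d n)"
      using orbit_poly_monic[OF assms(1)] by (simp add: k Suc del: orbit_poly.simps)
    hence "degree (orbit_poly d n - orbit_poly d m) = degree (orbit_poly d n)"
      using degree_add_eq_left[of "- orbit_poly d m" "orbit_poly d n"] by simp
    with deg show ?thesis
      using orbit_poly_monic[OF assms(1), of k] by (auto simp: coeff_eq_0 k simp del: orbit_poly.simps)
  qed
qed

text \<open>A repetition makes the orbit eventually periodic. For post-critical finiteness this form
  is an algebraic equation in the parameter, which passes to conjugates.\<close>

lemma finite_range_funpow_iff:
  fixes f :: "'a \<Rightarrow> 'a"
  shows "finite (range (\<lambda>n. (f ^^ n) x)) \<longleftrightarrow> (\<exists>m n. m < n \<and> (f ^^ m) x = (f ^^ n) x)"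
proof
  assume "finite (range (\<lambda>n. (f ^^ n) x))"
  hence "\<not> inj (\<lambda>n. (f ^^ n) x)" using range_inj_infinite by blast
  then obtain m n where "m \<noteq> n" "(f ^^ m) x = (f ^^ n) x" by (auto simp: inj_def)
  thus "\<exists>m n. m < n \<and> (f ^^ m) x = (f ^^ n) x" by (metis linorder_neqE_nat)
next
  assume "\<exists>m n. m < n \<and> (f ^^ m) x = (f ^^ n) x"
  then obtain m n where mn: "m < n" "(f ^^ m) x = (f ^^ n) x" by blast
  have "(f ^^ k) x \<in> (\<lambda>i. (f ^^ i) x) ` {..<n}" for k
  proof (induction k rule: less_induct)
    case (less k)
    show ?case
    proof (cases "k < n")
      case False
      \<comment> \<open>Shifting back by the period \<open>n - m\<close> replaces \<open>k\<close>
        by the smaller index \<open>k - n + m\<close>.\<close>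
      have "(f ^^ k) x = (f ^^ (k - n + n)) x" using False by simp
      also have "\<dots> = (f ^^ (k - n)) ((f ^^ n) x)" unfolding funpow_add by simp
      also have "\<dots> = (f ^^ (k - n + m)) x" by (simp add: funpow_add flip: mn(2))
      finally show ?thesis using less.IH[of "k - n + m"] mn(1) False by simp
    qed auto
  qed
  hence "range (\<lambda>n. (f ^^ n) x) \<subseteq> (\<lambda>i. (f ^^ i) x) ` {..<n}" by blast
  thus "finite (range (\<lambda>n. (f ^^ n) x))" by (rule finite_subset) auto
qed

lemma PCF_iff:
  "c \<in> PCF d \<longleftrightarrow>
     algebraic c \<and> (\<exists>m n. m < n \<and> (unicritical d c ^^ m) 0 = (unicritical d c ^^ n) 0)"
  by (simp add: PCF_def Qbar_def critical_orbit_def finite_range_funpow_iff)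

text \<open>A repetition says that \<open>c\<close> is a root of a monic integer polynomial
  \<open>P\<close>. The minimal polynomial divides \<open>P\<close>, so each conjugate has a
  repetition at the same two indices.\<close>

lemma PCF_algebraic_int_conjugates:
  assumes "d \<ge> 2" "c \<in> PCF d" "is_min_poly p c"
  shows "algebraic_int c" "poly (map_poly of_rat p) z = 0 \<Longrightarrow> finite (critical_orbit d z)"
proof -
  obtain m n where mn: "m < n" "(unicritical d c ^^ m) 0 = (unicritical d c ^^ n) 0"
    using assms(2) unfolding PCF_iff by blast
  define P where "P = orbit_poly d n - orbit_poly d m"
  have P: "poly (map_poly of_int P) z = (unicritical d z ^^ n) 0 - (unicritical d z ^^ m) 0" for z
    by (simp add: P_def map_poly_of_int_diff poly_orbit_poly)
  have root: "poly (map_poly of_int P) c = 0" by (simp add: P mn)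
  with orbit_poly_diff_monic[OF assms(1) mn(1)] show "algebraic_int c"
    unfolding algebraic_int_altdef_ipoly P_def by blast
  assume z: "poly (map_poly of_rat p) z = 0"
  have "p dvd map_poly of_int P"
    using assms(3) root by (intro is_min_poly_dvd) (simp_all add: map_poly_of_rat_of_int)
  then obtain q where "map_poly of_int P = p * q" by blast
  hence "map_poly of_int P = (map_poly of_rat p * map_poly of_rat q :: complex poly)"
    by (metis map_poly_of_rat_mult map_poly_of_rat_of_int)
  hence "poly (map_poly of_int P) z = 0" by (simp add: z)
  hence "(unicritical d z ^^ m) 0 = (unicritical d z ^^ n) 0" by (simp add: P)
  thus "finite (critical_orbit d z)"
    unfolding critical_orbit_def finite_range_funpow_iff using mn(1) by blast
qed

section \<open>Real dynamics\<close>

lemma finite_critical_orbit_of_real_iff: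
  "finite (critical_orbit d (of_real r)) \<longleftrightarrow> finite (range (\<lambda>n. ((\<lambda>x :: real. x ^ d + r) ^^ n) 0))"
proof -
  have "(unicritical d (of_real r) ^^ n) 0 = of_real (((\<lambda>x. x ^ d + r) ^^ n) 0)" for n
    by (induction n) (simp_all add: unicritical_def)
  hence "critical_orbit d (of_real r) = of_real ` range (\<lambda>n. ((\<lambda>x. x ^ d + r) ^^ n) 0)"
    by (auto simp: critical_orbit_def)
  thus ?thesis by (simp add: finite_image_iff inj_on_def)
qed

text \<open>The map \<open>x ^ d + r\<close> is strictly increasing on nonnegative reals, so one
  increase there propagates forever.\<close>

lemma infinite_orbit_of_increase:
  fixes r :: real and d :: nat
  defines "u \<equiv> \<lambda>n. ((\<lambda>x. x ^ d + r) ^^ n) 0"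
  assumes "d > 0" "u N \<ge> 0" "u N < u (Suc N)"
  shows "infinite (range u)"
proof -
  have "u (k + N) \<ge> 0 \<and> u (k + N) < u (Suc (k + N))" for k
  proof (induction k)
    case (Suc k)
    hence "u (k + N) ^ d < u (Suc (k + N)) ^ d" using assms(2) by (intro power_strict_mono) auto
    with Suc show ?case by (auto simp: u_def)
  qed (use assms in auto)
  hence "strict_mono (\<lambda>k. u (k + N))" by (simp add: strict_mono_Suc_iff)
  hence "infinite (range (\<lambda>k. u (k + N)))"
    by (intro range_inj_infinite strict_mono_imp_inj_on)
  thus ?thesis by (rule contrapos_nn) (auto elim: finite_subset[rotated])
qed

lemma finite_orbit_nonpos:
  fixes r :: real
  assumes "d > 0" "finite (critical_orbit d (of_real r))"
  shows "r \<le> 0"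
proof (rule ccontr)
  assume "\<not> r \<le> 0"
  hence "infinite (range (\<lambda>n. ((\<lambda>x :: real. x ^ d + r) ^^ n) 0))"
    \<comment> \<open>The orbit begins with the increase from 0 to \<open>r\<close>.\<close>
    using assms(1) by (intro infinite_orbit_of_increase[of _ 0]) (auto simp: power_0_left)
  with assms(2) show False by (simp add: finite_critical_orbit_of_real_iff)
qed

text \<open>For odd \<open>d\<close>, negation conjugates the map with parameter \<open>r\<close> to
  the one with \<open>- r\<close>; hence both parameters are nonpositive.\<close>

lemma finite_orbit_odd:
  fixes r :: real
  assumes "odd d" "finite (critical_orbit d (of_real r))"
  shows "r = 0"
proof -
  have d: "d > 0" using assms(1) by (rule odd_pos)
  have "((\<lambda>x. x ^ d + - r) ^^ n) 0 = - (((\<lambda>x. x ^ d + r) ^^ n) 0)" for n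
    using assms(1) by (induction n) (simp_all add: power_minus_odd)
  hence "range (\<lambda>n. ((\<lambda>x. x ^ d + - r) ^^ n) 0) = uminus ` range (\<lambda>n. ((\<lambda>x. x ^ d + r) ^^ n) 0)"
    by auto
  hence "finite (critical_orbit d (of_real (- r)))"
    using assms(2) unfolding finite_critical_orbit_of_real_iff by simp
  with assms(2) show ?thesis using finite_orbit_nonpos[OF d, of r] finite_orbit_nonpos[OF d, of "- r"] by simp
qed

text \<open>Otherwise the orbit, having reached its second iterate, escapes to the right. For
  \<open>d = 2\<close> the bound is 2 itself; for larger \<open>d\<close> it is strong enough to
  rule out the parameter -2.\<close>

lemma finite_orbit_even:
  fixes r :: real
  assumes "even d" "d > 0" "finite (critical_orbit d (of_real r))"
  shows "\<bar>r\<bar> ^ (d - 1) \<le> 2"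
proof (rule ccontr)
  assume *: "\<not> ?thesis"
  define a where "a = - r"
  define u where "u = (\<lambda>n. ((\<lambda>x. x ^ d + r) ^^ n) 0)"
  have "a \<ge> 0" using finite_orbit_nonpos[OF assms(2,3)] by (simp add: a_def)
  hence a: "a ^ (d - 1) > 2" using * by (simp add: a_def abs_if split: if_splits)
  have "d \<ge> 2" using assms(1,2) by (cases d) (auto elim: oddE)
  hence "a \<noteq> 0" using a by (auto simp: power_0_left)
  with \<open>a \<ge> 0\<close> have apos: "a > 0" by simp
  \<comment> \<open>Beyond \<open>a\<close> the power more than doubles its argument, which
    outweighs the subtraction of \<open>a\<close>.\<close>
  have pow: "x ^ d > 2 * x" if "x \<ge> a" for x
  proof -
    have "a ^ (d - 1) \<le> x ^ (d - 1)" using that apos by (intro power_mono) auto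
    hence "x * x ^ (d - 1) > x * 2" using a that apos by (intro mult_strict_left_mono) auto
    thus ?thesis using assms(2) by (simp add: power_eq_if[of x d] mult.commute)
  qed
  have "u 2 = a ^ d - a"
    using assms(1,2) by (simp add: u_def a_def numeral_2_eq_2 zero_power)
  hence "u 2 > a" using pow[of a] by simp
  moreover have "u (Suc 2) = u 2 ^ d - a" by (simp only: u_def a_def funpow.simps o_def)
  \<comment> \<open>Here \<open>u 2 ^ d - a > 2 * u 2 - a > u 2\<close>, using
    \<open>u 2 > a\<close>.\<close>
  ultimately have "u 2 < u (Suc 2)" "u 2 \<ge> 0"
    using pow[of "u 2"] apos by auto
  hence "infinite (range u)"
    unfolding u_def using assms(2) by (intro infinite_orbit_of_increase[of _ 2])
  with assms(3) show False unfolding finite_critical_orbit_of_real_iff u_def by simp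
qed

section \<open>Totally real post-critically finite parameters\<close>

lemma totally_real_PCF_conjugates:
  fixes z :: complex
  assumes "d \<ge> 2" "c \<in> PCF d" "c \<in> Qtr"
      and "poly (map_poly of_rat (min_poly c)) z = 0"
  obtains r :: real where "z = of_real r" "finite (critical_orbit d (of_real r))"
proof -
  have "algebraic c" "z \<in> \<real>" using assms by (auto simp: Qtr_def totally_real_def)
  thus ?thesis
    using that PCF_algebraic_int_conjugates(2)[OF assms(1,2) is_min_poly_min_poly assms(4)]
    by (auto elim: Reals_cases)
qed

lemma totally_real_PCF_self:
  assumes "d \<ge> 2" "c \<in> PCF d" "c \<in> Qtr"
  obtains r :: real where "c = of_real r" "finite (critical_orbit d (of_real r))"
proof -
  have "algebraic c" using assms by (simp add: Qtr_def totally_real_def)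
  hence "poly (map_poly of_rat (min_poly c)) c = 0"
    using is_min_poly_min_poly by (simp add: is_min_poly_def)
  from totally_real_PCF_conjugates[OF assms this] that show ?thesis by blast
qed

text \<open>The interval [-2, 0] containing all conjugates has integer centre -1 and radius 1, so
  the distance criterion applies with \<open>k = -1\<close>; the real points at distance 1 are the
  endpoints.\<close>

lemma totally_real_PCF_even:
  assumes "even d" "d \<ge> 2" and c: "c \<in> PCF d" "c \<in> Qtr"
  shows "c \<in> {-2, -1, 0}"
proof -
  have mp: "is_min_poly (min_poly c) c"
    using c(2) by (intro is_min_poly_min_poly) (simp add: Qtr_def totally_real_def)
  have near: "norm (of_int (-1) - z) \<le> 1" if z: "poly (map_poly of_rat (min_poly c)) z = 0" for z :: complex
  proof -
    obtain r :: real where r: "z = of_real r" "finite (critical_orbit d (of_real r))"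
      using totally_real_PCF_conjugates[OF assms(2) c z] .
    have "r \<le> 0" "\<bar>r\<bar> ^ (d - 1) \<le> 2"
      using finite_orbit_nonpos[OF _ r(2)] finite_orbit_even[OF assms(1) _ r(2)] assms(2) by auto
    \<comment> \<open>As \<open>d - 1\<close> is positive, a modulus above 2 would have its power
      above 2 too.\<close>
    moreover have "\<bar>r\<bar> \<le> \<bar>r\<bar> ^ (d - 1)" if "\<bar>r\<bar> > 2"
      using that assms(2) by (intro self_le_power) auto
    ultimately have "\<bar>- 1 - r\<bar> \<le> 1" by linarith
    moreover have "of_int (-1) - z = of_real (- 1 - r)" by (simp add: r)
    ultimately show ?thesis by (simp only: norm_of_real)
  qed
  have "c = of_int (-1) \<or> norm (of_int (-1) - c) = 1"
    using PCF_algebraic_int_conjugates(1)[OF assms(2) c(1) mp] mp near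
    by (rule algebraic_int_conjugates_near_int)
  moreover obtain r :: real where r: "c = of_real r"
    using totally_real_PCF_self[OF assms(2) c] .
  moreover have "of_int (-1) - c = of_real (- 1 - r)" by (simp add: r)
  ultimately have "c = -1 \<or> \<bar>- 1 - r\<bar> = 1" by (simp only: norm_of_real) auto
  hence "c = -1 \<or> r = -2 \<or> r = 0" by linarith
  thus ?thesis using r by auto
qed

section \<open>Membership of the parameters 0, -1 and -2\<close>

lemma of_int_in_PCF:
  assumes "m < n" "(unicritical d (of_int k) ^^ m) 0 = (unicritical d (of_int k) ^^ n) 0"
  shows "of_int k \<in> PCF d"
  using assms unfolding PCF_iff by (auto intro!: algebraic_int_imp_algebraic)

lemma zero_in_PCF:
  assumes "d > 0"
  shows "0 \<in> PCF d"
  using of_int_in_PCF[of 0 1 d 0] assms by (simp add: unicritical_def)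

text \<open>The critical orbit is the 2-cycle 0, -1, 0.\<close>

lemma minus_one_in_PCF:
  assumes "even d" "d > 0"
  shows "-1 \<in> PCF d"
  using of_int_in_PCF[of 0 "Suc (Suc 0)" d "-1"] assms by (simp add: unicritical_def zero_power)

text \<open>The critical orbit is 0, -2, 2, 2, ..., so the repetition is at indices 2 and 3.\<close>

lemma minus_two_in_PCF: "-2 \<in> PCF 2"
  using of_int_in_PCF[of "Suc (Suc 0)" "Suc (Suc (Suc 0))" 2 "-2"] by (simp add: unicritical_def)

lemma minus_two_notin_PCF:
  assumes "even d" "d \<ge> 4"
  shows "-2 \<notin> PCF d"
proof
  assume "-2 \<in> PCF d"
  hence "finite (critical_orbit d (of_real (-2)))" by (simp add: PCF_def)
  hence "(2::real) ^ (d - 1) \<le> 2" using finite_orbit_even[of d "-2"] assms by simp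
  moreover have "(2::real) ^ 3 \<le> 2 ^ (d - 1)" using assms by (intro power_increasing) auto
  ultimately show False by simp
qed

theorem theorem1p1:
  shows "PCF 2 \<inter> Qtr = {-2, -1, 0} \<and>
         (\<forall>d::nat. d \<ge> 4 \<and> even d \<longrightarrow> PCF d \<inter> Qtr = {-1, 0}) \<and>
         (\<forall>d::nat. d \<ge> 3 \<and> odd d \<longrightarrow> PCF d \<inter> Qtr = {0})"
proof (intro conjI allI impI)
  have real: "-2 \<in> Qtr" "-1 \<in> Qtr" "0 \<in> Qtr"
    using totally_real_of_int[of "-2"] totally_real_of_int[of "-1"] totally_real_of_int[of 0]
    by (simp_all add: Qtr_def)
  show "PCF 2 \<inter> Qtr = {-2, -1, 0}"
  proof
    show "PCF 2 \<inter> Qtr \<subseteq> {-2, -1, 0}"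
      using totally_real_PCF_even[of 2] by (intro subsetI) simp
    show "{-2, -1, 0} \<subseteq> PCF 2 \<inter> Qtr"
      using real minus_two_in_PCF minus_one_in_PCF[of 2] zero_in_PCF[of 2] by simp
  qed
  fix d :: nat
  {
    assume d: "d \<ge> 4 \<and> even d"
    show "PCF d \<inter> Qtr = {-1, 0}"
    proof
      show "PCF d \<inter> Qtr \<subseteq> {-1, 0}"
        \<comment> \<open>The even case leaves three candidates, of which -2 is now
          excluded.\<close>
        using totally_real_PCF_even[of d] minus_two_notin_PCF[of d] d by fastforce
      show "{-1, 0} \<subseteq> PCF d \<inter> Qtr"
        using real minus_one_in_PCF[of d] zero_in_PCF[of d] d by simp
    qed
  next
    assume d: "d \<ge> 3 \<and> odd d"
    show "PCF d \<inter> Qtr = {0}"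
    proof
      show "PCF d \<inter> Qtr \<subseteq> {0}"
      proof
        \<comment> \<open>For odd \<open>d\<close> it is enough that \<open>c\<close> itself is
          real; its other conjugates are not consulted.\<close>
        fix c assume "c \<in> PCF d \<inter> Qtr"
        then obtain r :: real where "c = of_real r" "finite (critical_orbit d (of_real r))"
          using totally_real_PCF_self[of d c] d by auto
        thus "c \<in> {0}" using finite_orbit_odd[of d r] d by simp
      qed
      show "{0} \<subseteq> PCF d \<inter> Qtr" using real zero_in_PCF[of d] d by simp
    qed
  }
qed

end
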